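(* Let $G$ be a finite connected loopless graph (multiple edges allowed), let $q\in V(G)$, and let $\sigma^\ast$ be an acyclic cocycle signature of $G$ (equivalently, an acyclic cocircuit signature of the graphic matroid of $G$). Let $$I_G^{\sigma^\ast}:\mathcal{ST}(G)\to\mathrm{Div}^0(G),\qquad T\mapsto D_{-(\vec{T^\ast})^c}+(q),\qquad \vec{T^\ast}\in\mathcal{A}^\ast_{\sigma^\ast},$$ be the function induced by $\sigma^\ast$. Then $\mathcal{BD}_{I_G^{\sigma^\ast}}(G)$ is a classical stability condition; that is, there is a generic numerical polarization $\phi$ on $G$ of degree $g=|E(G)|-|V(G)|+1$ such that $\mathcal{BD}_{I_G^{\sigma^\ast}}(G)=\mathcal{BD}_{I_{\mathfrak{n}(\phi)}}(G)$.
   Context: $\mathcal{ST}(G)$ is the set of spanning trees of $G$. A divisor on $G$ is a function $D:V(G)\to\mathbb{Z}$ of degree $\sum_v D(v)$; $\mathrm{Div}^d(G)$ is the set of divisors of degree $d$; $(q)$ is the divisor with value $1$ at $q$ and $0$ elsewhere. For a (real-valued) divisor $D$ and $W\subseteq V(G)$ write $D_W=\sum_{v\in W}D(v)$. For a graph $H$ connected, $g(H)=|E(H)|-|V(H)|+1$. An arc is an oriented edge. A fourientation of $G$ is a subset of the set of all arcs, so each edge is unoriented, one-way oriented, or bioriented. For a fourientation $\vec F$, $-\vec F$ reverses all one-way oriented edges, and $\vec F^c$ (set complement) reverses one-way oriented edges and interchanges unoriented and bioriented edges. For a fourientation $\vec F$ without bioriented edges, $D_{\vec F}(v)=\mathrm{indeg}_{\vec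 F}(v)-1$, where $\mathrm{indeg}_{\vec F}(v)$ counts the one-way oriented edges pointing to $v$. A subset $W\subset V(G)$ is biconnected if $G[W]$ and $G[W^c]$ are both connected, and nontrivial if $W,W^c\neq\emptyset$. A cocycle is an inclusion-minimal edge cut $C^\ast=E(W,W^c)$ ($W$ nontrivial biconnected); a signed cocycle $\vec{C^\ast}$ is $C^\ast$ with all edges oriented from $W$ to $W^c$, or all from $W^c$ to $W$. A cocycle signature $\sigma^\ast$ chooses one signed cocycle $\sigma^\ast(C^\ast)$ for each cocycle $C^\ast$. Fixing a reference orientation of $G$, identify $\sigma^\ast(C^\ast)$ with the vector in $\mathbb{R}^{E(G)}$ whose $e$-entry is $0$ if $e\notin C^\ast$, $1$ if $e$ is oriented in $\sigma^\ast(C^\ast)$ as in the reference orientation, and $-1$ otherwise. $\sigma^\ast$ is acyclic if $\sum_{C^\ast}a_{C^\ast}\sigma^\ast(C^\ast)=0$ with all $a_{C^\ast}\ge 0$ real implies all $a_{C^\ast}=0$. For $T\in\mathcal{ST}(G)$ and $e\in T$, the fundamental cocycle $C^\ast(T,e)$ is the set of edges joining the two components of $T\setminus e$. The internal atlas $\mathcal{A}^\ast_{\sigma^\ast}$ consists, for each $T\in\mathcal{ST}(G)$, of the fourientation $\vec{T^\ast}$ in which all edges outside $T$ are bioriented and each $e\in T$ is one-way oriented as in $\sigma^\ast(C^\ast(T,e))$. Thus $-(\vec{T^\ast})^c$ has edges of $T$ oriented as in $\vec{T^\ast}$ and all other edges unoriented. For $T\in\mathcal{ST}(G)$ and an orientation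 $\mathcal{O}_{\mathcal{E}_T}$ of $\mathcal{E}_T=E(G)\setminus T$, the break divisor $\mathcal{D}(T,\mathcal{O}_{\mathcal{E}_T})$ places one chip at the head of each oriented edge. For $I:\mathcal{ST}(G)\to\mathrm{Div}^0(G)$, $\mathcal{BD}_I(G)=\{\mathcal{D}(T,\mathcal{O}_{\mathcal{E}_T})+I(T)\}$, over all $T$ and all orientations $\mathcal{O}_{\mathcal{E}_T}$ of $\mathcal{E}_T$. A numerical polarization of degree $d\in\mathbb{Z}$ is a function $\phi:V(G)\to\mathbb{R}$ with $\sum_v\phi(v)=d$. It is generic if $\phi_W-\frac{|E(W,W^c)|}{2}\notin\mathbb{Z}$ for all nontrivial biconnected $W\subset V(G)$. For generic $\phi$ of degree $g$, $\mathfrak{n}(\phi)$ is the assignment $\mathfrak{n}(\phi)_W=\left\lceil\phi_W-\frac{|E(W,W^c)|}{2}\right\rceil$ for nontrivial biconnected $W$. For $\mathfrak{n}=\mathfrak{n}(\phi)$, $I_{\mathfrak{n}}(T)$ is the unique element of $\mathrm{Div}^0(G)$ such that for every $e\in T$, if $W_e$ and $W_e^c$ are the vertex sets of the two components of $T\setminus e$, then $I_{\mathfrak{n}}(T)_{W_e}=\mathfrak{n}_{W_e}-g(G[W_e])$ and $I_{\mathfrak{n}}(T)_{W_e^c}=\mathfrak{n}_{W_e^c}-g(G[W_e^c])$. *)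

theory Defs
  imports Complex_Main "Graph_Theory.Digraph_Component"
begin

text \<open>
  A finite connected loopless multigraph is represented by a finite digraph that contains every
  edge exactly once: the elements of \<open>arcs G\<close> are the edges, and \<open>tail\<close>/\<open>head\<close> record a
  reference orientation. Connectedness is that of the underlying undirected graph.
\<close>

locale connected_multigraph = fin_digraph G + loopfree_digraph G
  for G :: "('v, 'e) pre_digraph" +
  assumes connected_graph: "Digraph_Component.connected G"

text \<open>
  An oriented edge is a pair \<open>(e, b)\<close>: the edge \<open>e\<close> in its reference direction if \<open>b\<close> is true,
  and reversed otherwise. The following digraph has both oriented edges for each edge of \<open>G\<close>.
\<close>

definition bidirected :: "('v, 'e) pre_digraph \<Rightarrow> ('v, 'e \<times> bool) pre_digraph" where
  "bidirected G = \<lparr> verts = verts G, arcs = arcs G \<times> UNIV,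
     tail = (\<lambda>(e, b). if b then tail G e else head G e),
     head = (\<lambda>(e, b). if b then head G e else tail G e) \<rparr>"

definition genus :: "('v, 'e) pre_digraph \<Rightarrow> int" where
  "genus G = int (card (arcs G)) - int (card (verts G)) + 1"

definition spanning_subgraph :: "('v, 'e) pre_digraph \<Rightarrow> 'e set \<Rightarrow> ('v, 'e) pre_digraph" where
  "spanning_subgraph G S = G\<lparr>arcs := S\<rparr>"

text \<open>
  The notions \<open>forest\<close> and \<open>spanning_tree\<close> of the library only exclude directed cycles. A cycle
  of the undirected graph is a cycle of \<open>bidirected G\<close> in which no edge is used twice.
\<close>

definition undirected_cycle :: "('v, 'e) pre_digraph \<Rightarrow> ('e \<times> bool) list \<Rightarrow> bool" where
  "undirected_cycle G p \<longleftrightarrow> pre_digraph.cycle (bidirected G) p \<and> distinct (map fst p)"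

definition spanning_trees :: "('v, 'e) pre_digraph \<Rightarrow> 'e set set" where
  "spanning_trees G = {T. T \<subseteq> arcs G
     \<and> Digraph_Component.connected (spanning_subgraph G T)
     \<and> \<not> (\<exists>p. undirected_cycle (spanning_subgraph G T) p)}"

definition component_of :: "('v, 'e) pre_digraph \<Rightarrow> 'e set \<Rightarrow> 'v \<Rightarrow> 'v set" where
  "component_of G S v = {w \<in> verts G. reachable (mk_symmetric (spanning_subgraph G S)) v w}"

definition nontrivial :: "('v, 'e) pre_digraph \<Rightarrow> 'v set \<Rightarrow> bool" where
  "nontrivial G W \<longleftrightarrow> W \<subseteq> verts G \<and> W \<noteq> {} \<and> verts G - W \<noteq> {}"

definition biconnected :: "('v, 'e) pre_digraph \<Rightarrow> 'v set \<Rightarrow> bool" where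
  "biconnected G W \<longleftrightarrow> W \<subseteq> verts G \<and> Digraph_Component.connected (G \<restriction> W)
     \<and> Digraph_Component.connected (G \<restriction> (verts G - W))"

definition edge_cut :: "('v, 'e) pre_digraph \<Rightarrow> 'v set \<Rightarrow> 'e set" where
  "edge_cut G W = {e \<in> arcs G. (tail G e \<in> W) \<noteq> (head G e \<in> W)}"

definition directed_cut :: "('v, 'e) pre_digraph \<Rightarrow> 'v set \<Rightarrow> ('e \<times> bool) set" where
  "directed_cut G W = {a \<in> arcs (bidirected G).
     tail (bidirected G) a \<in> W \<and> head (bidirected G) a \<notin> W}"

definition cocycles :: "('v, 'e) pre_digraph \<Rightarrow> 'e set set" where
  "cocycles G = {C. (\<exists>W. nontrivial G W \<and> C = edge_cut G W)
     \<and> (\<forall>W. nontrivial G W \<longrightarrow> \<not> edge_cut G W \<subset> C)}"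

text \<open>
  Both directions of a cocycle occur here, since \<open>W\<close> may be replaced by its complement.
\<close>

definition signed_cocycles_on :: "('v, 'e) pre_digraph \<Rightarrow> 'e set \<Rightarrow> ('e \<times> bool) set set" where
  "signed_cocycles_on G C =
     {directed_cut G W | W. nontrivial G W \<and> biconnected G W \<and> edge_cut G W = C}"

definition cocycle_signature ::
    "('v, 'e) pre_digraph \<Rightarrow> ('e set \<Rightarrow> ('e \<times> bool) set) \<Rightarrow> bool" where
  "cocycle_signature G \<sigma> \<longleftrightarrow> (\<forall>C \<in> cocycles G. \<sigma> C \<in> signed_cocycles_on G C)"

definition signed_vector :: "('e \<times> bool) set \<Rightarrow> 'e \<Rightarrow> real" where
  "signed_vector S e = (if (e, True) \<in> S then 1 else if (e, False) \<in> S then - 1 else 0)"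

definition acyclic_signature ::
    "('v, 'e) pre_digraph \<Rightarrow> ('e set \<Rightarrow> ('e \<times> bool) set) \<Rightarrow> bool" where
  "acyclic_signature G \<sigma> \<longleftrightarrow> (\<forall>a :: 'e set \<Rightarrow> real.
     (\<forall>C \<in> cocycles G. 0 \<le> a C) \<longrightarrow>
     (\<forall>e \<in> arcs G. (\<Sum>C \<in> cocycles G. a C * signed_vector (\<sigma> C) e) = 0) \<longrightarrow>
     (\<forall>C \<in> cocycles G. a C = 0))"

definition fundamental_cocycle :: "('v, 'e) pre_digraph \<Rightarrow> 'e set \<Rightarrow> 'e \<Rightarrow> 'e set" where
  "fundamental_cocycle G T e = {f \<in> arcs G.
     component_of G (T - {e}) (tail G f) \<noteq> component_of G (T - {e}) (head G f)}"

text \<open>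
  Divisors are extended by zero outside \<open>verts G\<close>, so that equality of divisors is equality of
  functions. A fourientation is a subset of \<open>arcs (bidirected G)\<close>.
\<close>

definition divisors_of_degree :: "('v, 'e) pre_digraph \<Rightarrow> int \<Rightarrow> ('v \<Rightarrow> int) set" where
  "divisors_of_degree G d = {D. (\<forall>v. v \<notin> verts G \<longrightarrow> D v = 0) \<and> (\<Sum>v \<in> verts G. D v) = d}"

definition point_divisor :: "'v \<Rightarrow> 'v \<Rightarrow> int" where
  "point_divisor q v = (if v = q then 1 else 0)"

definition reverse_fourientation :: "('e \<times> bool) set \<Rightarrow> ('e \<times> bool) set" where
  "reverse_fourientation F = {(e, b). (e, \<not> b) \<in> F}"

definition complement_fourientation ::
    "('v, 'e) pre_digraph \<Rightarrow> ('e \<times> bool) set \<Rightarrow> ('e \<times> bool) set" where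
  "complement_fourientation G F = arcs (bidirected G) - F"

definition fourientation_indegree ::
    "('v, 'e) pre_digraph \<Rightarrow> ('e \<times> bool) set \<Rightarrow> 'v \<Rightarrow> nat" where
  "fourientation_indegree G F v =
     card {(e, b). (e, b) \<in> F \<and> (e, \<not> b) \<notin> F \<and> head (bidirected G) (e, b) = v}"

definition fourientation_divisor ::
    "('v, 'e) pre_digraph \<Rightarrow> ('e \<times> bool) set \<Rightarrow> 'v \<Rightarrow> int" where
  "fourientation_divisor G F v =
     (if v \<in> verts G then int (fourientation_indegree G F v) - 1 else 0)"

definition internal_atlas ::
    "('v, 'e) pre_digraph \<Rightarrow> ('e set \<Rightarrow> ('e \<times> bool) set) \<Rightarrow> 'e set \<Rightarrow> ('e \<times> bool) set" where
  "internal_atlas G \<sigma> T = {(e, b). e \<in> arcs G - T}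
     \<union> {(e, b). e \<in> T \<and> (e, b) \<in> \<sigma> (fundamental_cocycle G T e)}"

definition signature_shift ::
    "('v, 'e) pre_digraph \<Rightarrow> 'v \<Rightarrow> ('e set \<Rightarrow> ('e \<times> bool) set) \<Rightarrow> 'e set \<Rightarrow> 'v \<Rightarrow> int" where
  "signature_shift G q \<sigma> T = (\<lambda>v.
     fourientation_divisor G
       (reverse_fourientation (complement_fourientation G (internal_atlas G \<sigma> T))) v
     + point_divisor q v)"

definition orientations_of :: "'e set \<Rightarrow> ('e \<times> bool) set set" where
  "orientations_of E = {U. U \<subseteq> E \<times> UNIV \<and> (\<forall>e \<in> E. \<exists>!b. (e, b) \<in> U)}"

definition break_divisor :: "('v, 'e) pre_digraph \<Rightarrow> ('e \<times> bool) set \<Rightarrow> 'v \<Rightarrow> int" where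
  "break_divisor G U v = int (card {a \<in> U. head (bidirected G) a = v})"

definition shifted_break_divisors ::
    "('v, 'e) pre_digraph \<Rightarrow> ('e set \<Rightarrow> 'v \<Rightarrow> int) \<Rightarrow> ('v \<Rightarrow> int) set" where
  "shifted_break_divisors G I = {(\<lambda>v. break_divisor G U v + I T v) | T U.
     T \<in> spanning_trees G \<and> U \<in> orientations_of (arcs G - T)}"

definition numerical_polarization :: "('v, 'e) pre_digraph \<Rightarrow> int \<Rightarrow> ('v \<Rightarrow> real) \<Rightarrow> bool" where
  "numerical_polarization G d \<phi> \<longleftrightarrow> (\<Sum>v \<in> verts G. \<phi> v) = of_int d"

definition generic_polarization :: "('v, 'e) pre_digraph \<Rightarrow> ('v \<Rightarrow> real) \<Rightarrow> bool" where
  "generic_polarization G \<phi> \<longleftrightarrow> (\<forall>W. nontrivial G W \<and> biconnected G W \<longrightarrow>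
     (\<Sum>v \<in> W. \<phi> v) - real (card (edge_cut G W)) / 2 \<notin> \<int>)"

definition polarization_assignment ::
    "('v, 'e) pre_digraph \<Rightarrow> ('v \<Rightarrow> real) \<Rightarrow> 'v set \<Rightarrow> int" where
  "polarization_assignment G \<phi> W =
     \<lceil>(\<Sum>v \<in> W. \<phi> v) - real (card (edge_cut G W)) / 2\<rceil>"

definition assignment_shift ::
    "('v, 'e) pre_digraph \<Rightarrow> ('v set \<Rightarrow> int) \<Rightarrow> 'e set \<Rightarrow> 'v \<Rightarrow> int" where
  "assignment_shift G n T = (THE D. D \<in> divisors_of_degree G 0 \<and>
     (\<forall>e \<in> T. \<forall>W \<in> component_of G (T - {e}) ` verts G.
        (\<Sum>v \<in> W. D v) = n W - genus (G \<restriction> W)))"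

end

theory Submission
  imports Defs
begin

text \<open>
  Since \<open>\<sigma>\<close> is acyclic, Gordan's alternative yields edge weights \<open>w\<close> that have positive inner
  product with every signed cocycle \<open>\<sigma> C\<close>. Let \<open>p v\<close> be the net inflow of \<open>w\<close> into \<open>v\<close>, and let
  \<open>p\<^sub>W\<close> be its sum over \<open>W\<close>. Then \<open>\<sigma>\<close> orients the cut of a nontrivial biconnected \<open>W\<close> into \<open>W\<close> if
  \<open>p\<^sub>W > 0\<close> and out of \<open>W\<close> if \<open>p\<^sub>W < 0\<close>, and \<open>p\<^sub>W = 0\<close> never happens. Take the polarization
  \<open>\<phi> v = deg v / 2 - 1 + [v = q] + \<epsilon> p v\<close> with a small \<open>\<epsilon> > 0\<close>. For a component \<open>W\<close> of \<open>T - e\<close> the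
  ceiling that defines the assignment of \<open>\<phi>\<close> equals \<open>g(G[W]) - 1 + [q \<in> W] + [p\<^sub>W > 0]\<close>. As \<open>T\<close>
  has \<open>card W - 1\<close> edges inside \<open>W\<close>, the shift induced by \<open>\<sigma>\<close> sums over \<open>W\<close> to
  \<open>[q \<in> W] - 1 + [p\<^sub>W > 0]\<close>. Hence the two shifts agree at every spanning tree.
\<close>

subsection \<open>Gordan's alternative\<close>

text \<open>Neither the zero vector nor multiples by zero are put in, so the zero function lies in
  the hull exactly when some nontrivial nonnegative combination of \<open>S\<close> vanishes.
  Acyclicity excludes just this.\<close>

inductive_set conic_hull :: "('e \<Rightarrow> real) set \<Rightarrow> ('e \<Rightarrow> real) set" for S where
  base: "v \<in> S \<Longrightarrow> v \<in> conic_hull S"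
| add: "u \<in> conic_hull S \<Longrightarrow> v \<in> conic_hull S \<Longrightarrow> (\<lambda>e. u e + v e) \<in> conic_hull S"
| scale: "v \<in> conic_hull S \<Longrightarrow> 0 < c \<Longrightarrow> (\<lambda>e. c * v e) \<in> conic_hull S"

lemma conic_hull_subset:
  assumes "S' \<subseteq> conic_hull S"
  shows "conic_hull S' \<subseteq> conic_hull S"
proof
  fix v assume "v \<in> conic_hull S'"
  then show "v \<in> conic_hull S"
    by induction (use assms in \<open>auto intro: conic_hull.intros\<close>)
qed

text \<open>Coefficients belong to indices rather than vectors, to match
  \<open>acyclic_signature\<close>. A generator has one positive coefficient, and neither addition
  nor positive scaling destroys it.\<close>

lemma conic_hull_image:
  assumes "finite I" "v \<in> conic_hull (f ` I)"
  shows "\<exists>a. (\<forall>i\<in>I. 0 \<le> a i) \<and> (\<exists>i\<in>I. 0 < a i) \<and> v = (\<lambda>e. \<Sum>i\<in>I. a i * f i e)"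
  using assms(2)
proof induction
  case (base v)
  then obtain i where i: "i \<in> I" "v = f i" by auto
  have "v = (\<lambda>e. \<Sum>j\<in>I. of_bool (j = i) * f j e)"
  proof
    fix e
    have "(\<Sum>j\<in>I. of_bool (j = i) * f j e) = (\<Sum>j\<in>I. if j = i then f j e else 0)"
      by (rule sum.cong) auto
    then show "v e = (\<Sum>j\<in>I. of_bool (j = i) * f j e)"
      using i assms(1) by simp
  qed
  then show ?case
    using i by (intro exI[of _ "\<lambda>j. of_bool (j = i)"]) auto
next
  case (add u v)
  then obtain a b where
    "\<forall>i\<in>I. 0 \<le> a i" "\<exists>i\<in>I. 0 < a i" "u = (\<lambda>e. \<Sum>i\<in>I. a i * f i e)"
    "\<forall>i\<in>I. 0 \<le> b i" "v = (\<lambda>e. \<Sum>i\<in>I. b i * f i e)"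
    by blast
  then show ?case
    by (intro exI[of _ "\<lambda>i. a i + b i"])
       (auto simp: distrib_right sum.distrib intro: add_pos_nonneg)
next
  case (scale v c)
  then obtain a where
    "\<forall>i\<in>I. 0 \<le> a i" "\<exists>i\<in>I. 0 < a i" "v = (\<lambda>e. \<Sum>i\<in>I. a i * f i e)"
    by blast
  then show ?case
    using \<open>0 < c\<close> by (intro exI[of _ "\<lambda>i. c * a i"])
         (auto simp: sum_distrib_left mult.assoc zero_less_mult_iff)
qed

text \<open>Places the weight of an eliminated coordinate between its lower bounds \<open>A\<close>
  and its upper bounds \<open>B\<close>; either set may be empty.\<close>

lemma finite_sets_separated:
  fixes A B :: "real set"
  assumes "finite A" "finite B" "\<And>a b. a \<in> A \<Longrightarrow> b \<in> B \<Longrightarrow> a < b"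
  shows "\<exists>t. (\<forall>a\<in>A. a < t) \<and> (\<forall>b\<in>B. t < b)"
proof (cases "A = {} \<or> B = {}")
  case True
  then show ?thesis
  proof
    assume "A = {}"
    \<comment> \<open>Inserting \<open>0\<close> keeps the minimum defined when \<open>B\<close> is
      empty as well.\<close>
    moreover have "Min (insert 0 B) \<le> b" if "b \<in> B" for b
      using assms(2) that by simp
    ultimately show ?thesis
      by (intro exI[of _ "Min (insert 0 B) - 1"]) fastforce
  next
    assume "B = {}"
    moreover have "a \<le> Max (insert 0 A)" if "a \<in> A" for a
      using assms(1) that by simp
    ultimately show ?thesis
      by (intro exI[of _ "Max (insert 0 A) + 1"]) fastforce
  qed
next
  case False
  then have "Max A < Min B" using assms by auto
  then obtain t where "Max A < t" "t < Min B" using dense by blast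
  then show ?thesis using assms False by auto
qed

text \<open>Fourier--Motzkin elimination of one coordinate per induction step.\<close>

lemma gordan:
  assumes "finite E" "finite S" "\<And>v. v \<in> conic_hull S \<Longrightarrow> \<exists>e\<in>E. v e \<noteq> 0"
  shows "\<exists>w. \<forall>v\<in>S. 0 < (\<Sum>e\<in>E. w e * v e)"
  using assms
proof (induction E arbitrary: S rule: finite_induct)
  case empty
  then have "S = {}" using conic_hull.base by fastforce
  then show ?case by simp
next
  case (insert x E)
  define P where "P = {v\<in>S. 0 < v x}"
  define N where "N = {v\<in>S. v x < 0}"
  \<comment> \<open>The multipliers \<open>v x\<close> and \<open>- u x\<close> are positive and
    make the two \<open>x\<close>-entries cancel. So \<open>S'\<close> stays in the hull of
    \<open>S\<close> but vanishes at \<open>x\<close>.\<close>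
  define S' where "S' = {v\<in>S. v x = 0} \<union> (\<lambda>(v, u) e. v x * u e + (- u x) * v e) ` (P \<times> N)"
  have fin: "finite P" "finite N" "finite S'"
    using insert.prems(1) by (auto simp: P_def N_def S'_def)
  have S'_sub: "S' \<subseteq> conic_hull S"
  proof -
    have "(\<lambda>e. v x * u e + (- u x) * v e) \<in> conic_hull S" if "v \<in> P" "u \<in> N" for v u
      using that unfolding P_def N_def
      by (intro conic_hull.add conic_hull.scale conic_hull.base) auto
    then show ?thesis
      unfolding S'_def by (auto intro: conic_hull.base)
  qed
  have zero: "v x = 0" if "v \<in> conic_hull S'" for v
    using that by induction (auto simp: S'_def)
  \<comment> \<open>The nonzero entry promised for the hull of \<open>S\<close> cannot sit at
    \<open>x\<close>, so it sits in \<open>E\<close>.\<close>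
  have "\<exists>e\<in>E. v e \<noteq> 0" if v: "v \<in> conic_hull S'" for v
    using insert.prems(2)[of v] conic_hull_subset[OF S'_sub] zero[OF v] v by auto
  from insert.IH[OF fin(3) this] obtain w where w: "\<forall>v\<in>S'. 0 < (\<Sum>e\<in>E. w e * v e)"
    by blast
  define L where "L v = (\<Sum>e\<in>E. w e * v e)" for v
  \<comment> \<open>A weight \<open>t\<close> at \<open>x\<close> must exceed
    \<open>- L v / v x\<close> for \<open>v\<close> in \<open>P\<close> and stay below
    \<open>L u / (- u x)\<close> for \<open>u\<close> in \<open>N\<close>. Positivity on the
    combined vectors says that these bounds are compatible.\<close>
  have cross: "- L v / v x < L u / (- u x)" if "v \<in> P" "u \<in> N" for v u
  proof -
    have "(\<lambda>e. v x * u e + (- u x) * v e) \<in> S'"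
      using that by (auto simp: S'_def)
    then have "0 < L (\<lambda>e. v x * u e + (- u x) * v e)"
      using w by (auto simp: L_def)
    also have "L (\<lambda>e. v x * u e + (- u x) * v e) = v x * L u + (- u x) * L v"
      unfolding L_def sum_distrib_left sum.distrib[symmetric]
      by (rule sum.cong) (auto simp: algebra_simps)
    finally show ?thesis
      using that by (auto simp: P_def N_def field_simps)
  qed
  have "\<exists>t. (\<forall>a\<in>(\<lambda>v. - L v / v x) ` P. a < t) \<and> (\<forall>b\<in>(\<lambda>u. L u / (- u x)) ` N. t < b)"
    using fin cross by (intro finite_sets_separated) auto
  then obtain t where t: "\<And>v. v \<in> P \<Longrightarrow> - L v / v x < t" "\<And>u. u \<in> N \<Longrightarrow> t < L u / (- u x)"
    by auto
  have "0 < (\<Sum>e\<in>insert x E. (w(x := t)) e * v e)" if "v \<in> S" for v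
  proof -
    have "(\<Sum>e\<in>E. (w(x := t)) e * v e) = L v"
      unfolding L_def using insert.hyps(2) by (intro sum.cong) auto
    then have eq: "(\<Sum>e\<in>insert x E. (w(x := t)) e * v e) = t * v x + L v"
      using insert.hyps by simp
    consider "v x = 0" | "0 < v x" | "v x < 0" by linarith
    then have "0 < t * v x + L v"
    proof cases
      case 1
      then show ?thesis using w that by (auto simp: S'_def L_def)
    next
      case 2
      then show ?thesis using t(1)[of v] that by (auto simp: P_def field_simps)
    next
      case 3
      then show ?thesis using t(2)[of v] that by (auto simp: N_def field_simps)
    qed
    then show ?thesis using eq by simp
  qed
  then show ?case by blast
qed

section \<open>From acyclicity to positive edge weights\<close>

lemma finite_cocycles:
  assumes "finite (arcs G)"
  shows "finite (cocycles G)"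
  by (rule finite_subset[of _ "Pow (arcs G)"]) (auto simp: cocycles_def edge_cut_def assms)

text \<open>If a vector of the conic hull vanished on all edges, acyclicity would force all its
  coefficients to be zero, yet one of them is positive. Gordan's alternative then supplies the
  weights.\<close>

lemma acyclic_signature_positive_weights:
  assumes "finite (arcs G)" "acyclic_signature G \<sigma>"
  shows "\<exists>w. \<forall>C\<in>cocycles G. 0 < (\<Sum>e\<in>arcs G. w e * signed_vector (\<sigma> C) e)"
proof -
  let ?f = "\<lambda>C. signed_vector (\<sigma> C)"
  have fin: "finite (cocycles G)" by (rule finite_cocycles) fact
  have "\<exists>w. \<forall>v\<in>?f ` cocycles G. 0 < (\<Sum>e\<in>arcs G. w e * v e)"
  proof (rule gordan)
    fix v assume "v \<in> conic_hull (?f ` cocycles G)"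
    from conic_hull_image[OF fin this] obtain a where
      a: "\<forall>C\<in>cocycles G. 0 \<le> a C" "\<exists>C\<in>cocycles G. 0 < a C"
        "v = (\<lambda>e. \<Sum>C\<in>cocycles G. a C * ?f C e)"
      by blast
    show "\<exists>e\<in>arcs G. v e \<noteq> 0"
    proof (rule ccontr)
      assume "\<not> ?thesis"
      then have "\<forall>e\<in>arcs G. (\<Sum>C\<in>cocycles G. a C * ?f C e) = 0" using a(3) by auto
      then have "\<forall>C\<in>cocycles G. a C = 0"
        using assms(2) a(1) unfolding acyclic_signature_def by blast
      then show False using a(2) by auto
    qed
  qed (use assms fin in auto)
  then show ?thesis by auto
qed

subsection \<open>Connectivity\<close>

text \<open>No edge of \<open>S\<close> leaves \<open>X\<close>. Connectivity is handled through
  such sets instead of paths. \<open>X\<close> need not lie in the vertex set, so complements of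
  closed sets are again closed.\<close>

definition edge_closed :: "('v, 'e) pre_digraph \<Rightarrow> 'e set \<Rightarrow> 'v set \<Rightarrow> bool" where
  "edge_closed G S X \<longleftrightarrow> (\<forall>e\<in>S. tail G e \<in> X \<longleftrightarrow> head G e \<in> X)"

lemma reachable_mk_symmetric_closed:
  assumes "reachable (with_proj (mk_symmetric H)) u v" "edge_closed H (arcs H) X" "u \<in> X"
  shows "v \<in> X"
  using assms(1) unfolding reachable_def
  by (induction rule: rtrancl_on_induct)
     (use assms(2,3) in \<open>auto simp: parcs_mk_symmetric edge_closed_def\<close>)

lemma (in wf_digraph) edge_closed_reachable:
  "edge_closed G (arcs G) {v. reachable (with_proj (mk_symmetric G)) u v}"
  unfolding edge_closed_def reachable_def
  by (auto simp: parcs_mk_symmetric intro: rtrancl_on_into_rtrancl_on)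

text \<open>The set of vertices reachable from \<open>u\<close> is closed, and no walk leaves a
  closed set.\<close>

lemma (in wf_digraph) connected_iff_edge_closed:
  "Digraph_Component.connected G \<longleftrightarrow> verts G \<noteq> {} \<and>
    (\<forall>X. edge_closed G (arcs G) X \<longrightarrow> verts G \<inter> X \<noteq> {} \<longrightarrow> verts G \<subseteq> X)"
proof (intro iffI conjI allI impI)
  assume "Digraph_Component.connected G"
  then show "verts G \<noteq> {}"
    by (auto simp: Digraph_Component.connected_def strongly_connected_def)
  fix X assume X: "edge_closed G (arcs G) X" "verts G \<inter> X \<noteq> {}"
  then obtain u where "u \<in> verts G" "u \<in> X" by auto
  then show "verts G \<subseteq> X"
    using \<open>Digraph_Component.connected G\<close> reachable_mk_symmetric_closed[OF _ X(1)]
    by (auto simp: Digraph_Component.connected_def strongly_connected_def)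
next
  assume conn: "verts G \<noteq> {} \<and>
    (\<forall>X. edge_closed G (arcs G) X \<longrightarrow> verts G \<inter> X \<noteq> {} \<longrightarrow> verts G \<subseteq> X)"
  have "reachable (with_proj (mk_symmetric G)) u v" if "u \<in> verts G" "v \<in> verts G" for u v
  proof -
    have "u \<in> {v. reachable (with_proj (mk_symmetric G)) u v}"
      using that by (auto simp: reachable_def)
    then show ?thesis using conn edge_closed_reachable[of u] that by blast
  qed
  then show "Digraph_Component.connected G"
    using conn by (auto simp: Digraph_Component.connected_def strongly_connected_def)
qed

lemma wf_digraph_bidirected:
  assumes "wf_digraph H"
  shows "wf_digraph (bidirected H)"
proof -
  interpret wf_digraph H by fact
  show ?thesis by unfold_locales (auto simp: bidirected_def)
qed

context connected_multigraph
begin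

abbreviation "component \<equiv> component_of G"

lemma wf_spanning_subgraph:
  "S \<subseteq> arcs G \<Longrightarrow> wf_digraph (spanning_subgraph G S)"
  by unfold_locales (auto simp: spanning_subgraph_def)

lemma component_of_subset: "component S v \<subseteq> verts G"
  by (auto simp: component_of_def)

lemma finite_component_of: "finite (component S v)"
  using component_of_subset finite_verts by (rule finite_subset)

lemma component_of_self: "v \<in> verts G \<Longrightarrow> v \<in> component S v"
  by (auto simp: component_of_def reachable_def spanning_subgraph_def)

lemma edge_closed_component_of:
  assumes "S \<subseteq> arcs G"
  shows "edge_closed G S (component S v)"
  using wf_digraph.edge_closed_reachable[OF wf_spanning_subgraph[OF assms], of v] assms
  unfolding edge_closed_def component_of_def
  by (auto simp: spanning_subgraph_def)

text \<open>Together with \<open>edge_closed_component_of\<close> this characterizes a component as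
  the least closed set around its vertex; inclusions between components are derived from it.\<close>

lemma component_of_least:
  assumes "edge_closed G S X" "v \<in> X"
  shows "component S v \<subseteq> X"
  using reachable_mk_symmetric_closed[of "spanning_subgraph G S" v _ X] assms
  by (auto simp: component_of_def edge_closed_def spanning_subgraph_def)

lemma component_of_eq:
  assumes "S \<subseteq> arcs G" "v \<in> verts G" "u \<in> component S v"
  shows "component S u = component S v"
proof
  show "component S u \<subseteq> component S v"
    by (rule component_of_least[OF edge_closed_component_of]) (use assms in auto)
  have "v \<in> component S u"
  proof (rule ccontr)
    assume "v \<notin> component S u"
    \<comment> \<open>Passing to the closed complement gives the symmetry of reachability.\<close>
    moreover have "edge_closed G S (- component S u)"
      using edge_closed_component_of[OF assms(1), of u] by (auto simp: edge_closed_def)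
    ultimately have "component S v \<subseteq> - component S u"
      by (intro component_of_least) auto
    then show False
      using assms component_of_subset component_of_self by blast
  qed
  then show "component S v \<subseteq> component S u"
    by (intro component_of_least edge_closed_component_of assms)
qed

lemma component_of_mono:
  assumes "S \<subseteq> S'" "S' \<subseteq> arcs G" "v \<in> verts G"
  shows "component S v \<subseteq> component S' v"
  by (rule component_of_least)
     (use edge_closed_component_of[OF assms(2), of v] assms component_of_self
       in \<open>auto simp: edge_closed_def\<close>)

lemma component_of_eq_verts:
  assumes "S \<subseteq> arcs G" "Digraph_Component.connected (spanning_subgraph G S)" "v \<in> verts G"
  shows "component S v = verts G"
proof
  have "edge_closed (spanning_subgraph G S) (arcs (spanning_subgraph G S)) (component S v)"
    using edge_closed_component_of[OF assms(1)]
    by (auto simp: edge_closed_def spanning_subgraph_def)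
  then have "verts (spanning_subgraph G S) \<subseteq> component S v"
    using assms component_of_self[of v S]
      wf_digraph.connected_iff_edge_closed[OF wf_spanning_subgraph[OF assms(1)]]
    by (fastforce simp: spanning_subgraph_def)
  then show "verts G \<subseteq> component S v" by (simp add: spanning_subgraph_def)
qed (rule component_of_subset)

section \<open>Edge cuts of biconnected vertex sets\<close>

lemma connected_induce_iff:
  assumes "W \<subseteq> verts G"
  shows "Digraph_Component.connected (G \<restriction> W) \<longleftrightarrow> W \<noteq> {} \<and>
    (\<forall>X. edge_closed G {e \<in> arcs G. tail G e \<in> W \<and> head G e \<in> W} X \<longrightarrow> W \<inter> X \<noteq> {} \<longrightarrow> W \<subseteq> X)"
proof -
  interpret W: wf_digraph "G \<restriction> W" by (rule wellformed_induce_subgraph)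
  show ?thesis
    unfolding W.connected_iff_edge_closed by (simp add: edge_closed_def)
qed

lemma edge_cut_Diff: "edge_cut G (verts G - W) = edge_cut G W"
  by (auto simp: edge_cut_def)

text \<open>No edge inside \<open>W\<close> or inside its complement crosses \<open>W'\<close>, so
  each of these two connected halves is contained in \<open>W'\<close> or disjoint from it. Hence
  the cut of \<open>W\<close> is minimal and determines \<open>W\<close> up to complement.\<close>

lemma edge_cut_subset_biconnected:
  assumes "biconnected G W" "nontrivial G W'" "edge_cut G W' \<subseteq> edge_cut G W"
  shows "W' = W \<or> W' = verts G - W"
proof -
  have W: "W \<subseteq> verts G" "Digraph_Component.connected (G \<restriction> W)"
    "Digraph_Component.connected (G \<restriction> (verts G - W))"
    using assms(1) by (auto simp: biconnected_def)
  have cl: "edge_closed G {e \<in> arcs G. tail G e \<in> V \<and> head G e \<in> V} W'"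
    if "V = W \<or> V = verts G - W" for V
    using assms(3) that by (auto simp: edge_closed_def edge_cut_def)
  have "W \<inter> W' \<noteq> {} \<longrightarrow> W \<subseteq> W'"
    using W cl[of W] connected_induce_iff[OF W(1)] by blast
  moreover have "(verts G - W) \<inter> W' \<noteq> {} \<longrightarrow> verts G - W \<subseteq> W'"
    using W cl[of "verts G - W"] connected_induce_iff[of "verts G - W"] by blast
  ultimately show ?thesis
    using assms(2) W(1) unfolding nontrivial_def by blast
qed

lemma edge_cut_in_cocycles:
  assumes "nontrivial G W" "biconnected G W"
  shows "edge_cut G W \<in> cocycles G"
  using edge_cut_subset_biconnected[OF assms(2)] assms(1) edge_cut_Diff
  unfolding cocycles_def by blast

subsection \<open>Spanning trees\<close>

lemma spanning_treesD:
  assumes "T \<in> spanning_trees G"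
  shows "T \<subseteq> arcs G" "finite T" "\<And>v. v \<in> verts G \<Longrightarrow> component T v = verts G"
  using assms component_of_eq_verts finite_subset[OF _ finite_arcs]
  by (auto simp: spanning_trees_def)

text \<open>A second use of an edge, in either direction, would visit its tail again, whereas an
  \<open>apath\<close> repeats no vertex. This supplies the distinctness demanded by
  \<open>undirected_cycle\<close>.\<close>

lemma distinct_edges_apath:
  assumes "wf_digraph (bidirected H)" "pre_digraph.apath (bidirected H) u p v"
  shows "distinct (map fst p)"
  using assms(2)
proof (induction p arbitrary: u)
  case (Cons a p)
  interpret B: wf_digraph "bidirected H" by fact
  have path: "B.apath (head (bidirected H) a) p v"
    and notin: "tail (bidirected H) a \<notin> set (B.awalk_verts (head (bidirected H) a) p)"
    using Cons.prems by (auto simp: B.apath_Cons_iff)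
  have "fst a \<notin> fst ` set p"
  proof
    assume "fst a \<in> fst ` set p"
    then obtain b where b: "b \<in> set p" "fst b = fst a" by auto
    then have "tail (bidirected H) a \<in> {tail (bidirected H) b, head (bidirected H) b}"
      by (auto simp: bidirected_def split: prod.splits)
    then show False
      using notin B.awalk_verts_arc1[OF b(1)] B.awalk_verts_arc2[OF B.awalkI_apath[OF path] b(1)]
      by auto
  qed
  then show ?case using Cons.IH[OF path] by auto
qed simp

text \<open>Otherwise a path in \<open>T - {e}\<close> from the head of \<open>e\<close> back to its
  tail would close up with \<open>e\<close> to an undirected cycle in \<open>T\<close>.\<close>

lemma spanning_tree_separates:
  assumes T: "T \<in> spanning_trees G" and e: "e \<in> T"
  shows "head G e \<notin> component (T - {e}) (tail G e)"
proof
  assume asm: "head G e \<in> component (T - {e}) (tail G e)"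
  let ?H = "spanning_subgraph G (T - {e})"
  let ?B = "bidirected ?H" and ?B' = "bidirected (spanning_subgraph G T)"
  have sub: "T \<subseteq> arcs G" using T by (auto simp: spanning_trees_def)
  interpret B: wf_digraph ?B
    using sub by (intro wf_digraph_bidirected wf_spanning_subgraph) auto
  interpret B': wf_digraph ?B'
    using sub by (intro wf_digraph_bidirected wf_spanning_subgraph)
  have "tail G e \<in> component (T - {e}) (head G e)"
    using component_of_eq[OF _ _ asm] sub e component_of_self[of "tail G e"] tail_in_verts by blast
  then have "reachable (with_proj (mk_symmetric ?H)) (head G e) (tail G e)"
    by (simp add: component_of_def)
  moreover have "arcs_ends (with_proj (mk_symmetric ?H)) \<subseteq> arcs_ends ?B"
    
    by (force simp: parcs_mk_symmetric arcs_ends_def arc_to_ends_def bidirected_def)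
  ultimately have "reachable ?B (head G e) (tail G e)"
    unfolding reachable_def
    by (auto elim!: rtrancl_on_mono[rotated 2] simp: bidirected_def)
  then obtain p where p: "B.apath (head G e) p (tail G e)"
    using B.reachable_apath by blast
  \<comment> \<open>The two digraphs share their end maps and differ only in their arcs, so the path
    may be read in \<open>?B'\<close>, where \<open>e\<close> is available.\<close>
  have compat_B: "compatible ?B ?B'"
    by (auto simp: compatible_def bidirected_def spanning_subgraph_def)
  have compat: "B.cas = B'.cas" "B.awalk_verts = B'.awalk_verts"
    using compatible_cas[OF compat_B] compatible_awalk_verts[OF compat_B] by auto
  have "set p \<subseteq> arcs ?B"
    using B.awalkI_apath[OF p] by blast
  then have fst_p: "fst ` set p \<subseteq> T - {e}"
    by (auto simp: bidirected_def spanning_subgraph_def)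
  have ends: "tail ?B' (e, True) = tail G e" "head ?B' (e, True) = head G e"
    "set ((e, True) # p) \<subseteq> arcs ?B'" "tail G e \<in> verts ?B'"
    using fst_p e sub by (auto simp: bidirected_def spanning_subgraph_def)
  have "B'.cas (head G e) p (tail G e)" "distinct (B'.awalk_verts (head G e) p)"
    using p unfolding B.apath_def B.awalk_def compat by blast+
  then have "B'.awalk (tail G e) ((e, True) # p) (tail G e)"
    and "distinct (tl (B'.awalk_verts (tail G e) ((e, True) # p)))"
    unfolding B'.awalk_def using ends by simp_all
  then have "B'.cycle ((e, True) # p)"
    unfolding B'.cycle_def by blast
  moreover have "distinct (map fst ((e, True) # p))"
    using distinct_edges_apath[OF B.wf_digraph p] fst_p by auto
  ultimately show False
    using T unfolding spanning_trees_def undirected_cycle_def by blast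
qed

text \<open>The edge count of a tree, for each component of a forest; the forest condition is that
  every edge separates its ends. Since components are closed, counting edges by their tails counts
  exactly the edges inside.\<close>

lemma card_edges_component_of:
  assumes "finite S" "S \<subseteq> arcs G" "\<And>e. e \<in> S \<Longrightarrow> head G e \<notin> component (S - {e}) (tail G e)"
    and "v \<in> verts G"
  shows "card {f \<in> S. tail G f \<in> component S v} + 1 = card (component S v)"
  using assms
proof (induction S arbitrary: v rule: finite_induct)
  case empty
  have "component {} v \<subseteq> {v}"
    by (rule component_of_least) (auto simp: edge_closed_def)
  then have "component {} v = {v}" using component_of_self[OF empty(3)] by blast
  then show ?case by simp
next
  case (insert e S)
  have sub: "S \<subseteq> arcs G" and e: "tail G e \<in> verts G" "head G e \<in> verts G"
    using insert.prems by auto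
  \<comment> \<open>Deleting edges only shrinks components, so the separation property passes to the
    smaller edge set.\<close>
  have forest: "head G f \<notin> component (S - {f}) (tail G f)" if "f \<in> S" for f
  proof -
    have "component (S - {f}) (tail G f) \<subseteq> component (insert e S - {f}) (tail G f)"
      using insert.prems(1) that by (intro component_of_mono) auto
    then show ?thesis using insert.prems(2)[of f] that by auto
  qed
  have IH: "card {f \<in> S. tail G f \<in> component S u} + 1 = card (component S u)"
    if "u \<in> verts G" for u
    using insert.IH[OF sub _ that] forest by blast
  let ?A = "component S (tail G e)" and ?B = "component S (head G e)"
  have cl: "edge_closed G S (component S u)" for u by (rule edge_closed_component_of[OF sub])
  show ?case
  \<comment> \<open>Either \<open>e\<close> merges the disjoint components \<open>?A\<close> and
    \<open>?B\<close> into the one of \<open>v\<close>, giving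
    \<open>1 + (card ?A - 1) + (card ?B - 1)\<close> edges, or it does not touch the component of
    \<open>v\<close>.\<close>
  proof (cases "v \<in> ?A \<union> ?B")
    case True
    have "head G e \<notin> ?A"
      using insert.prems(2)[of e] insert.hyps by simp
    then have disj: "?A \<inter> ?B = {}"
      using component_of_eq[OF sub] e component_of_self by blast
    have eq: "component (insert e S) v = ?A \<union> ?B"
    proof
      show "component (insert e S) v \<subseteq> ?A \<union> ?B"
        by (rule component_of_least)
           (use True cl component_of_self e in \<open>auto simp: edge_closed_def\<close>)
      let ?D = "component (insert e S) v"
      have clD: "edge_closed G (insert e S) ?D"
        using insert.prems(1) by (rule edge_closed_component_of)
      then have clD': "edge_closed G S ?D" "tail G e \<in> ?D \<longleftrightarrow> head G e \<in> ?D"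
        by (auto simp: edge_closed_def)
      have "component S v \<subseteq> ?D"
        using clD'(1) component_of_self[OF insert.prems(3)] by (rule component_of_least)
      moreover have "component S v = ?A \<or> component S v = ?B"
        using True component_of_eq[OF sub] e by blast
      ultimately have "tail G e \<in> ?D" "head G e \<in> ?D"
        using component_of_self e clD'(2) by blast+
      then show "?A \<union> ?B \<subseteq> ?D"
        using component_of_least[OF clD'(1)] by blast
    qed
    have "{f \<in> insert e S. tail G f \<in> ?A \<union> ?B} =
        insert e ({f \<in> S. tail G f \<in> ?A} \<union> {f \<in> S. tail G f \<in> ?B})"
      using component_of_self e by auto
    moreover have "card \<dots> = Suc (card {f \<in> S. tail G f \<in> ?A} + card {f \<in> S. tail G f \<in> ?B})"
      using insert.hyps disj by (subst card_insert_disjoint) (auto intro!: card_Un_disjoint)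
    ultimately show ?thesis
      using IH[OF e(1)] IH[OF e(2)] card_Un_disjoint[OF finite_component_of finite_component_of disj]
      by (simp add: eq)
  next
    case False
    then have notin: "tail G e \<notin> component S v" "head G e \<notin> component S v"
      using component_of_eq[OF sub insert.prems(3)] component_of_self[OF insert.prems(3)] by blast+
    have "component (insert e S) v = component S v"
    proof
      show "component (insert e S) v \<subseteq> component S v"
        by (rule component_of_least)
           (use notin cl component_of_self insert.prems in \<open>auto simp: edge_closed_def\<close>)
      show "component S v \<subseteq> component (insert e S) v"
        using insert.prems by (intro component_of_mono) auto
    qed
    moreover have "{f \<in> insert e S. tail G f \<in> component S v} = {f \<in> S. tail G f \<in> component S v}"
      using notin by auto
    ultimately show ?thesis using IH[OF insert.prems(3)] by simp
  qed
qed

section \<open>Fundamental components of a spanning tree\<close>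

lemma fundamental_components:
  assumes T: "T \<in> spanning_trees G" and e: "e \<in> T"
  shows "component (T - {e}) (head G e) = verts G - component (T - {e}) (tail G e)"
    and "v \<in> verts G \<Longrightarrow> component (T - {e}) v \<in>
      {component (T - {e}) (tail G e), component (T - {e}) (head G e)}"
proof -
  let ?A = "component (T - {e}) (tail G e)" and ?B = "component (T - {e}) (head G e)"
  have sub: "T - {e} \<subseteq> arcs G" and ends: "tail G e \<in> verts G" "head G e \<in> verts G"
    using spanning_treesD(1)[OF T] e by auto
  have cl: "edge_closed G (T - {e}) (component (T - {e}) u)" for u
    by (rule edge_closed_component_of[OF sub])
  \<comment> \<open>The union contains both ends of \<open>e\<close>, so it is closed under all of
    \<open>T\<close> and exhausts the vertices by connectedness.\<close>
  have "edge_closed G T (?A \<union> ?B)"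
    unfolding edge_closed_def
  proof
    fix f assume "f \<in> T"
    then show "tail G f \<in> ?A \<union> ?B \<longleftrightarrow> head G f \<in> ?A \<union> ?B"
      using cl component_of_self ends by (cases "f = e") (auto simp: edge_closed_def)
  qed
  then have "component T (tail G e) \<subseteq> ?A \<union> ?B"
    by (rule component_of_least) (use component_of_self ends in auto)
  then have cover: "verts G \<subseteq> ?A \<union> ?B"
    using spanning_treesD(3)[OF T ends(1)] by simp
  have "?A \<inter> ?B = {}"
  proof (rule ccontr)
    assume "?A \<inter> ?B \<noteq> {}"
    then obtain x where x: "x \<in> ?A" "x \<in> ?B" by blast
    then have "?A = ?B"
      using component_of_eq[OF sub ends(1) x(1)] component_of_eq[OF sub ends(2) x(2)] by simp
    then show False
      using spanning_tree_separates[OF T e] component_of_self[OF ends(2)] by simp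
  qed
  then show "?B = verts G - ?A"
    using cover component_of_subset[of "T - {e}" "head G e"] by auto
  show "component (T - {e}) v \<in> {?A, ?B}" if "v \<in> verts G"
  proof -
    consider "v \<in> ?A" | "v \<in> ?B" using cover \<open>v \<in> verts G\<close> by blast
    then show ?thesis
    proof cases
      case 1
      then show ?thesis using component_of_eq[OF sub ends(1) 1] by simp
    next
      case 2
      then show ?thesis using component_of_eq[OF sub ends(2) 2] by simp
    qed
  qed
qed

lemma fundamental_component_biconnected:
  assumes T: "T \<in> spanning_trees G" and e: "e \<in> T"
  defines "W \<equiv> component (T - {e}) (tail G e)"
  shows "nontrivial G W" "biconnected G W" "edge_cut G W = fundamental_cocycle G T e"
proof -
  have sub: "T - {e} \<subseteq> arcs G" and ends: "tail G e \<in> verts G" "head G e \<in> verts G"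
    using spanning_treesD(1)[OF T] e by auto
  have compl: "component (T - {e}) (head G e) = verts G - W"
    unfolding W_def by (rule fundamental_components(1)[OF T e])
  show "nontrivial G W"
    using component_of_self[OF ends(1), of "T - {e}"] component_of_self[OF ends(2), of "T - {e}"]
      component_of_subset[of "T - {e}" "tail G e"]
    unfolding nontrivial_def compl by (auto simp: W_def)
  have conn: "Digraph_Component.connected (G \<restriction> component (T - {e}) u)" if u: "u \<in> verts G" for u
  proof -
    let ?V = "component (T - {e}) u"
    have cl: "edge_closed G (T - {e}) ?V" by (rule edge_closed_component_of[OF sub])
    have "?V \<subseteq> X"
      if X: "edge_closed G {f \<in> arcs G. tail G f \<in> ?V \<and> head G f \<in> ?V} X" "?V \<inter> X \<noteq> {}" for X
    proof -
      from X(2) obtain x where x: "x \<in> ?V" "x \<in> X" by auto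
      \<comment> \<open>Edges of \<open>T - {e}\<close> never leave \<open>?V\<close>, and those
        inside it are edges of the induced subgraph. The tree edges alone thus connect
        \<open>?V\<close>.\<close>
      have "edge_closed G (T - {e}) (X \<inter> ?V)"
        using X(1) cl sub by (auto simp: edge_closed_def)
      then have "component (T - {e}) x \<subseteq> X \<inter> ?V"
        by (rule component_of_least) (use x in auto)
      then show ?thesis using component_of_eq[OF sub u x(1)] by auto
    qed
    then show ?thesis
      unfolding connected_induce_iff[OF component_of_subset]
      using component_of_self[OF u] by blast
  qed
  show "biconnected G W"
    using conn[OF ends(1), folded W_def] conn[OF ends(2), unfolded compl]
      component_of_subset[of "T - {e}" "tail G e", folded W_def]
    unfolding biconnected_def by blast
  have "component (T - {e}) x = component (T - {e}) y \<longleftrightarrow> (x \<in> W \<longleftrightarrow> y \<in> W)"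
    if "x \<in> verts G" "y \<in> verts G" for x y
    using fundamental_components(2)[OF T e] that component_of_self compl component_of_eq[OF sub]
      ends unfolding W_def by (metis DiffD2 insert_iff singletonD)
  then show "edge_cut G W = fundamental_cocycle G T e"
    unfolding edge_cut_def fundamental_cocycle_def using wellformed by blast
qed

text \<open>
  A function on the vertices is a constant plus a combination of the indicators of the
  fundamental components of \<open>T\<close>, with its differences along \<open>T\<close> as coefficients.
\<close>

lemma divisor_eq_0_if_sums_fundamental_components_eq_0:
  fixes D :: "'v \<Rightarrow> int"
  assumes T: "T \<in> spanning_trees G"
    and total: "(\<Sum>x\<in>verts G. D x) = 0"
    and comps: "\<And>e. e \<in> T \<Longrightarrow> (\<Sum>x\<in>component (T - {e}) (head G e). D x) = 0"
    and v: "v \<in> verts G"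
  shows "D v = 0"
proof -
  define f :: "'v \<Rightarrow> int" where "f x = of_bool (x = v)" for x
  define d where "d e = f (head G e) - f (tail G e)" for e
  define H where "H e = component (T - {e}) (head G e)" for e
  define h where "h x = f x - (\<Sum>e\<in>T. d e * of_bool (x \<in> H e))" for x
  have sub: "T \<subseteq> arcs G" and fin: "finite T" using spanning_treesD[OF T] by auto
  have H: "tail G e \<notin> H e" "head G e \<in> H e" if "e \<in> T" for e
    using fundamental_components(1)[OF T that] spanning_tree_separates[OF T that] component_of_self
      sub that unfolding H_def by auto
  \<comment> \<open>For \<open>e\<close> other than \<open>e'\<close> the set \<open>H e\<close> is
    closed under \<open>e'\<close>. Crossing \<open>e'\<close> therefore changes only its own
    summand, by \<open>d e'\<close>, which is the change of \<open>f\<close>.\<close>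
  have step: "h (head G e') = h (tail G e')" if e': "e' \<in> T" for e'
  proof -
    have "head G e' \<in> H e \<longleftrightarrow> tail G e' \<in> H e" if "e \<in> T - {e'}" for e
      using edge_closed_component_of[of "T - {e}" "head G e"] sub e' that
      unfolding H_def edge_closed_def by auto
    then have "(\<Sum>e\<in>T - {e'}. d e * of_bool (head G e' \<in> H e)) =
        (\<Sum>e\<in>T - {e'}. d e * of_bool (tail G e' \<in> H e))"
      by (intro sum.cong) auto
    then show ?thesis
      unfolding h_def sum.remove[OF fin e'] using H[OF e'] by (simp add: d_def)
  qed
  have const: "h x = h v" if "x \<in> verts G" for x
  proof -
    have "component T v \<subseteq> {x. h x = h v}"
      by (rule component_of_least) (use step in \<open>auto simp: edge_closed_def\<close>)
    then show ?thesis using spanning_treesD(3)[OF T v] that by auto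
  qed
  have "D v = (\<Sum>x\<in>verts G. D x * f x)"
    using v by (simp add: f_def)
  \<comment> \<open>Pairing \<open>D\<close> with this decomposition of \<open>f\<close> leaves
    nothing: the total degree kills the constant and \<open>comps\<close> kills every
    indicator.\<close>
  also have "\<dots> = (\<Sum>x\<in>verts G. D x * h v + (\<Sum>e\<in>T. d e * (D x * of_bool (x \<in> H e))))"
  proof (rule sum.cong)
    fix x assume "x \<in> verts G"
    then have "f x = h v + (\<Sum>e\<in>T. d e * of_bool (x \<in> H e))"
      using const[of x] by (simp add: h_def)
    then show "D x * f x = D x * h v + (\<Sum>e\<in>T. d e * (D x * of_bool (x \<in> H e)))"
      by (simp add: distrib_left sum_distrib_left algebra_simps)
  qed simp
  also have "\<dots> = h v * (\<Sum>x\<in>verts G. D x) +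
      (\<Sum>e\<in>T. d e * (\<Sum>x\<in>verts G. D x * of_bool (x \<in> H e)))"
    unfolding sum.distrib sum_distrib_left
    by (subst sum.swap) (simp add: mult.commute)
  also have "(\<Sum>e\<in>T. d e * (\<Sum>x\<in>verts G. D x * of_bool (x \<in> H e))) = 0"
  proof (rule sum.neutral, rule ballI)
    fix e assume e: "e \<in> T"
    have "(\<Sum>x\<in>verts G. D x * of_bool (x \<in> H e)) = (\<Sum>x\<in>H e. D x)"
      using component_of_subset unfolding H_def
      by (intro sum.mono_neutral_cong_right) auto
    then show "d e * (\<Sum>x\<in>verts G. D x * of_bool (x \<in> H e)) = 0"
      using comps[OF e] by (simp add: H_def)
  qed
  finally show ?thesis using total by simp
qed

text \<open>The given \<open>D\<close> settles existence for the definite description. Uniqueness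
  holds because the difference of two solutions sums to zero on the whole graph and on every
  fundamental component.\<close>

lemma assignment_shift_eqI:
  assumes T: "T \<in> spanning_trees G" and D: "D \<in> divisors_of_degree G 0"
    and comps: "\<And>e W. \<lbrakk>e \<in> T; W \<in> component (T - {e}) ` verts G\<rbrakk>
      \<Longrightarrow> (\<Sum>v\<in>W. D v) = n W - genus (G \<restriction> W)"
  shows "assignment_shift G n T = D"
  unfolding assignment_shift_def
proof (rule the_equality)
  show "D \<in> divisors_of_degree G 0 \<and>
      (\<forall>e\<in>T. \<forall>W\<in>component (T - {e}) ` verts G. (\<Sum>v\<in>W. D v) = n W - genus (G \<restriction> W))"
    using D comps by blast
next
  fix D' assume D': "D' \<in> divisors_of_degree G 0 \<and>
      (\<forall>e\<in>T. \<forall>W\<in>component (T - {e}) ` verts G. (\<Sum>v\<in>W. D' v) = n W - genus (G \<restriction> W))"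
  have "D' v - D v = 0" if "v \<in> verts G" for v
  proof (rule divisor_eq_0_if_sums_fundamental_components_eq_0[OF T _ _ that])
    show "(\<Sum>x\<in>verts G. D' x - D x) = 0"
      using D D' by (auto simp: divisors_of_degree_def sum_subtractf)
    fix e assume e: "e \<in> T"
    then have "component (T - {e}) (head G e) \<in> component (T - {e}) ` verts G"
      using spanning_treesD(1)[OF T] by auto
    then show "(\<Sum>x\<in>component (T - {e}) (head G e). D' x - D x) = 0"
      using D' comps[OF e] e by (auto simp: sum_subtractf)
  qed
  moreover have "D' v = D v" if "v \<notin> verts G" for v
    using that D D' by (auto simp: divisors_of_degree_def)
  ultimately show "D' = D" by (intro ext) (metis eq_iff_diff_eq_0)
qed

subsection \<open>The orientation induced by positive weights\<close>

text \<open>Edges with both ends on the same side of \<open>W\<close> contribute zero, so this is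
  the net flow across the cut into \<open>W\<close>.\<close>

definition inflow :: "('e \<Rightarrow> real) \<Rightarrow> 'v set \<Rightarrow> real" where
  "inflow w W = (\<Sum>e\<in>arcs G. w e * (of_bool (head G e \<in> W) - of_bool (tail G e \<in> W)))"

lemma sum_of_bool_point:
  assumes "finite W"
  shows "(\<Sum>v\<in>W. of_bool (x = v)) = (of_bool (x \<in> W) :: 'c :: semiring_1)"
  using assms by (simp add: of_bool_def)

lemma sum_inflow:
  assumes "finite W"
  shows "(\<Sum>v\<in>W. inflow w {v}) = inflow w W"
  unfolding inflow_def
  by (subst sum.swap)
     (simp add: sum_of_bool_point[OF assms] sum_subtractf flip: sum_distrib_left)

lemma inflow_Diff: "inflow w (verts G - W) = - inflow w W"
  unfolding inflow_def sum_negf[symmetric] by (rule sum.cong) auto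

text \<open>The minus sign appears because \<open>directed_cut G W\<close> points out of
  \<open>W\<close>.\<close>

lemma sum_signed_vector_directed_cut:
  "(\<Sum>e\<in>arcs G. w e * signed_vector (directed_cut G W) e) = - inflow w W"
  unfolding inflow_def sum_negf[symmetric]
  by (rule sum.cong) (auto simp: signed_vector_def directed_cut_def bidirected_def)

context
  fixes \<sigma> :: "'e set \<Rightarrow> ('e \<times> bool) set" and w :: "'e \<Rightarrow> real"
  assumes sig: "cocycle_signature G \<sigma>"
    and positive: "\<forall>C\<in>cocycles G. 0 < (\<Sum>e\<in>arcs G. w e * signed_vector (\<sigma> C) e)"
begin

text \<open>The signature directs the cut out of some \<open>W'\<close>, and positivity makes the
  inflow of \<open>W'\<close> negative. As \<open>W'\<close> is \<open>W\<close> or its complement,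
  whose inflows are opposite, the sign of the inflow identifies it.\<close>

lemma signature_edge_cut:
  assumes "nontrivial G W" "biconnected G W"
  shows "inflow w W \<noteq> 0"
    and "\<sigma> (edge_cut G W) = directed_cut G (if inflow w W < 0 then W else verts G - W)"
proof -
  have C: "edge_cut G W \<in> cocycles G" by (rule edge_cut_in_cocycles) fact+
  then obtain W' where W': "\<sigma> (edge_cut G W) = directed_cut G W'" "nontrivial G W'"
      "edge_cut G W' = edge_cut G W"
    using sig by (force simp: cocycle_signature_def signed_cocycles_on_def)
  then have neg: "inflow w W' < 0"
    using positive C sum_signed_vector_directed_cut[of w W'] by force
  consider "W' = W" | "W' = verts G - W"
    using edge_cut_subset_biconnected[OF assms(2) W'(2)] W'(3) by blast
  then have "inflow w W \<noteq> 0 \<and>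
      \<sigma> (edge_cut G W) = directed_cut G (if inflow w W < 0 then W else verts G - W)"
    by cases (use neg in \<open>simp_all add: W'(1) inflow_Diff\<close>)
  then show "inflow w W \<noteq> 0"
      "\<sigma> (edge_cut G W) = directed_cut G (if inflow w W < 0 then W else verts G - W)"
    by blast+
qed

text \<open>The end of a tree edge \<open>e\<close> to which \<sigma> directs it in its fundamental
  cocycle, expressed through the weights: negative inflow at the tail side means that the cut is
  directed towards the head side.\<close>

definition induced_head :: "'e set \<Rightarrow> 'e \<Rightarrow> 'v" where
  "induced_head T e =
    (if inflow w (component (T - {e}) (tail G e)) < 0 then head G e else tail G e)"

lemma signature_fundamental_cocycle:
  assumes T: "T \<in> spanning_trees G" and e: "e \<in> T"
  shows "(e, b) \<in> \<sigma> (fundamental_cocycle G T e) \<longleftrightarrow>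
    b = (inflow w (component (T - {e}) (tail G e)) < 0)"
proof -
  note bic = fundamental_component_biconnected[OF T e]
  have "tail G e \<in> component (T - {e}) (tail G e)" "head G e \<notin> component (T - {e}) (tail G e)"
    "e \<in> arcs G" "head G e \<in> verts G"
    using spanning_tree_separates[OF T e] spanning_treesD(1)[OF T] e component_of_self by auto
  then show ?thesis
    using signature_edge_cut(2)[OF bic(1,2)] unfolding bic(3)
    by (auto simp: directed_cut_def bidirected_def)
qed

lemma induced_head_in_fundamental_component:
  assumes T: "T \<in> spanning_trees G" and e: "e \<in> T"
    and W: "W \<in> component (T - {e}) ` verts G"
  shows "induced_head T e \<in> W \<longleftrightarrow> 0 < inflow w W"
    and "nontrivial G W" and "biconnected G W"
proof -
  define A where "A = component (T - {e}) (tail G e)"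
  note bic = fundamental_component_biconnected[OF T e, folded A_def]
  have W': "W = A \<or> W = verts G - A"
    using W fundamental_components(2)[OF T e]
    unfolding fundamental_components(1)[OF T e] A_def by blast
  have ends: "tail G e \<in> A" "head G e \<notin> A" "head G e \<in> verts G"
    using spanning_tree_separates[OF T e] spanning_treesD(1)[OF T] e component_of_self
    unfolding A_def by auto
  have head: "induced_head T e = (if inflow w A < 0 then head G e else tail G e)"
    by (simp only: induced_head_def A_def)
  from W' show "induced_head T e \<in> W \<longleftrightarrow> 0 < inflow w W"
    unfolding head using ends signature_edge_cut(1)[OF bic(1,2)]
    by (elim disjE) (simp_all add: inflow_Diff)
  have "A \<subseteq> verts G" unfolding A_def by (rule component_of_subset)
  then have "nontrivial G (verts G - A)" "biconnected G (verts G - A)"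
    using bic(1,2) by (auto simp: nontrivial_def biconnected_def double_diff)
  then show "nontrivial G W" "biconnected G W"
    using W' bic(1,2) by metis+
qed

section \<open>The shift induced by the signature and its sums\<close>

lemma fourientation_indegree_internal_atlas:
  assumes T: "T \<in> spanning_trees G"
  shows "fourientation_indegree G
      (reverse_fourientation (complement_fourientation G (internal_atlas G \<sigma> T))) v =
    card {e \<in> T. induced_head T e = v}"
proof -
  define F where "F = reverse_fourientation (complement_fourientation G (internal_atlas G \<sigma> T))"
  define \<beta> where "\<beta> e = (inflow w (component (T - {e}) (tail G e)) < 0)" for e
  have "(e, b) \<in> internal_atlas G \<sigma> T \<longleftrightarrow> e \<in> arcs G - T \<or> e \<in> T \<and> b = \<beta> e" for e b
    using signature_fundamental_cocycle[OF T, of e b, folded \<beta>_def]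
    by (auto simp: internal_atlas_def)
  \<comment> \<open>Complementing unorients the edges outside \<open>T\<close> and reverses those in
    \<open>T\<close>; the final reversal restores the directions of the latter.\<close>
  then have F: "(e, b) \<in> F \<longleftrightarrow> e \<in> T \<and> b = \<beta> e" for e b
    using spanning_treesD(1)[OF T]
    unfolding F_def reverse_fourientation_def complement_fourientation_def bidirected_def
    by auto
  have head: "head (bidirected G) (e, \<beta> e) = induced_head T e" for e
    by (simp add: bidirected_def induced_head_def \<beta>_def)
  have eq: "{(e, b). (e, b) \<in> F \<and> (e, \<not> b) \<notin> F \<and> head (bidirected G) (e, b) = v} =
      (\<lambda>e. (e, \<beta> e)) ` {e \<in> T. induced_head T e = v}"
    using head by (auto simp: F)
  show ?thesis
    unfolding fourientation_indegree_def F_def[symmetric] eq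
    by (rule card_image) (simp add: inj_on_def)
qed

lemma sum_signature_shift:
  assumes T: "T \<in> spanning_trees G" and W: "W \<subseteq> verts G"
  shows "(\<Sum>v\<in>W. signature_shift G q \<sigma> T v) =
    int (card {e \<in> T. induced_head T e \<in> W}) - int (card W) + of_bool (q \<in> W)"
proof -
  have fin: "finite W" "finite T"
    using finite_subset[OF W] spanning_treesD(2)[OF T] by auto
  have "signature_shift G q \<sigma> T v =
      (\<Sum>e\<in>T. of_bool (induced_head T e = v)) - 1 + of_bool (q = v)" if "v \<in> W" for v
    using that W fin
    by (auto simp: signature_shift_def fourientation_divisor_def point_divisor_def
        fourientation_indegree_internal_atlas[OF T] Int_def)
  then have "(\<Sum>v\<in>W. signature_shift G q \<sigma> T v) =
      (\<Sum>v\<in>W. (\<Sum>e\<in>T. of_bool (induced_head T e = v)) - 1 + of_bool (q = v))"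
    by (rule sum.cong[OF refl])
  also have "\<dots> = (\<Sum>e\<in>T. \<Sum>v\<in>W. of_bool (induced_head T e = v)) - int (card W) + of_bool (q \<in> W)"
    by (subst sum.swap) (simp add: sum.distrib sum_subtractf sum_of_bool_point fin)
  also have "(\<Sum>e\<in>T. \<Sum>v\<in>W. of_bool (induced_head T e = v)) =
      int (card {e \<in> T. induced_head T e \<in> W})"
  proof -
    have "(\<Sum>e\<in>T. \<Sum>v\<in>W. of_bool (induced_head T e = v)) =
        (\<Sum>e\<in>T. of_bool (induced_head T e \<in> W) :: int)"
      by (intro sum.cong refl sum_of_bool_point fin)
    then show ?thesis using fin by (simp add: Int_def)
  qed
  finally show ?thesis .
qed

lemma sum_signature_shift_fundamental_component:
  assumes T: "T \<in> spanning_trees G" and e: "e \<in> T"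
    and W: "W \<in> component (T - {e}) ` verts G"
  shows "(\<Sum>v\<in>W. signature_shift G q \<sigma> T v) =
    of_bool (0 < inflow w W) + of_bool (q \<in> W) - 1"
proof -
  from W obtain u where u: "u \<in> verts G" "W = component (T - {e}) u" by auto
  have sub: "T - {e} \<subseteq> arcs G" and fin: "finite T"
    using spanning_treesD[OF T] by auto
  have "head G f \<notin> component (T - {e} - {f}) (tail G f)" if "f \<in> T - {e}" for f
  proof -
    have "component (T - {e} - {f}) (tail G f) \<subseteq> component (T - {f}) (tail G f)"
      using spanning_treesD(1)[OF T] that by (intro component_of_mono) auto
    then show ?thesis using spanning_tree_separates[OF T, of f] that by auto
  qed
  then have "card {f \<in> T - {e}. tail G f \<in> W} + 1 = card W"
    unfolding u(2) using fin sub u(1) by (intro card_edges_component_of) auto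
  \<comment> \<open>Each such edge has both ends in \<open>W\<close> or neither, so its orientation
    is irrelevant here; only \<open>e\<close> can make a difference.\<close>
  moreover have "{f \<in> T - {e}. induced_head T f \<in> W} = {f \<in> T - {e}. tail G f \<in> W}"
    using edge_closed_component_of[OF sub, of u]
    by (auto simp: u(2) edge_closed_def induced_head_def)
  moreover have "card {f \<in> T. induced_head T f \<in> W} =
      card {f \<in> T - {e}. induced_head T f \<in> W} + of_bool (induced_head T e \<in> W)"
  proof (cases "induced_head T e \<in> W")
    case True
    then have "{f \<in> T. induced_head T f \<in> W} = insert e {f \<in> T - {e}. induced_head T f \<in> W}"
      using e by blast
    then show ?thesis using fin True by simp
  next
    case False
    then have "{f \<in> T. induced_head T f \<in> W} = {f \<in> T - {e}. induced_head T f \<in> W}"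
      by blast
    then show ?thesis using False by simp
  qed
  ultimately have "int (card {f \<in> T. induced_head T f \<in> W}) =
      int (card W) - 1 + of_bool (induced_head T e \<in> W)"
    by simp
  then have "int (card {f \<in> T. induced_head T f \<in> W}) =
      int (card W) - 1 + of_bool (0 < inflow w W)"
    unfolding induced_head_in_fundamental_component(1)[OF T e W] .
  moreover have "W \<subseteq> verts G" using u(2) component_of_subset by simp
  ultimately show ?thesis
    unfolding sum_signature_shift[OF T \<open>W \<subseteq> verts G\<close>] by linarith
qed

lemma signature_shift_degree_0:
  assumes T: "T \<in> spanning_trees G" and q: "q \<in> verts G"
  shows "signature_shift G q \<sigma> T \<in> divisors_of_degree G 0"
proof -
  have sub: "T \<subseteq> arcs G" and fin: "finite T" using spanning_treesD[OF T] by auto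
  \<comment> \<open>\<open>T\<close> has one edge fewer than \<open>G\<close> has vertices; the chip
    at \<open>q\<close> makes up for it.\<close>
  have "card {f \<in> T. tail G f \<in> component T q} + 1 = card (component T q)"
    using fin sub q spanning_tree_separates[OF T] by (intro card_edges_component_of) auto
  moreover have "{f \<in> T. tail G f \<in> verts G} = T" "{f \<in> T. induced_head T f \<in> verts G} = T"
    using sub by (auto simp: induced_head_def)
  ultimately have "(\<Sum>v\<in>verts G. signature_shift G q \<sigma> T v) = 0"
    using sum_signature_shift[OF T, of "verts G" q] q by (simp add: spanning_treesD(3)[OF T q])
  moreover have "signature_shift G q \<sigma> T v = 0" if "v \<notin> verts G" for v
    using that q by (auto simp: signature_shift_def fourientation_divisor_def point_divisor_def)
  ultimately show ?thesis by (simp add: divisors_of_degree_def)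
qed

end

subsection \<open>The polarization\<close>

definition vertex_degree :: "'v \<Rightarrow> real" where
  "vertex_degree v = (\<Sum>e\<in>arcs G. of_bool (tail G e = v) + of_bool (head G e = v))"

text \<open>An edge inside \<open>W\<close> is counted at both ends, a cut edge at one.\<close>

lemma sum_vertex_degree:
  assumes "W \<subseteq> verts G"
  shows "(\<Sum>v\<in>W. vertex_degree v) = 2 * real (card (arcs (G \<restriction> W))) + real (card (edge_cut G W))"
proof -
  have fin: "finite W" using assms finite_verts by (rule finite_subset)
  have "(\<Sum>v\<in>W. vertex_degree v) =
      (\<Sum>e\<in>arcs G. of_bool (tail G e \<in> W) + of_bool (head G e \<in> W))"
    unfolding vertex_degree_def
    by (subst sum.swap) (simp add: sum.distrib sum_of_bool_point[OF fin])
  also have "\<dots> = (\<Sum>e\<in>arcs G. 2 * of_bool (tail G e \<in> W \<and> head G e \<in> W) +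
      of_bool ((tail G e \<in> W) \<noteq> (head G e \<in> W)))"
    by (rule sum.cong) auto
  also have "\<dots> = 2 * real (card (arcs (G \<restriction> W))) + real (card (edge_cut G W))"
    unfolding sum.distrib sum_distrib_left[symmetric]
    by (simp add: edge_cut_def Int_def)
  finally show ?thesis .
qed

text \<open>Without the \<epsilon> term this is half the canonical divisor, of degree
  \<open>g - 1\<close>, plus the point \<open>q\<close>. The \<epsilon> term breaks ties without
  changing the degree.\<close>

definition perturbed_polarization :: "'v \<Rightarrow> real \<Rightarrow> ('e \<Rightarrow> real) \<Rightarrow> 'v \<Rightarrow> real" where
  "perturbed_polarization q \<epsilon> w v =
    vertex_degree v / 2 - 1 + of_bool (q = v) + \<epsilon> * inflow w {v}"

text \<open>Subtracting half the cut from half the degree sum leaves the number of edges inside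
  \<open>W\<close>, hence an integer apart from the perturbation.\<close>

lemma sum_perturbed_polarization:
  assumes "W \<subseteq> verts G"
  shows "(\<Sum>v\<in>W. perturbed_polarization q \<epsilon> w v) - real (card (edge_cut G W)) / 2 =
    of_int (genus (G \<restriction> W) - 1 + of_bool (q \<in> W)) + \<epsilon> * inflow w W"
proof -
  have fin: "finite W" using assms finite_verts by (rule finite_subset)
  have "(\<Sum>v\<in>W. perturbed_polarization q \<epsilon> w v) =
      (\<Sum>v\<in>W. vertex_degree v) / 2 - real (card W) + of_bool (q \<in> W) + \<epsilon> * inflow w W"
    unfolding perturbed_polarization_def
    by (simp add: sum.distrib sum_subtractf sum_of_bool_point[OF fin] sum_inflow[OF fin]
        flip: sum_divide_distrib sum_distrib_left)
  then show ?thesis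
    by (simp add: sum_vertex_degree[OF assms] genus_def add_divide_distrib)
qed

lemma exists_small_inflow:
  "\<exists>\<epsilon>>0. \<forall>W\<subseteq>verts G. \<bar>\<epsilon> * inflow w W\<bar> < 1"
proof -
  \<comment> \<open>The summand \<open>1\<close> makes the bound strict and keeps \<open>M\<close>
    positive even if all weights vanish.\<close>
  define M where "M = 1 + (\<Sum>e\<in>arcs G. \<bar>w e\<bar>)"
  have M: "0 < M" unfolding M_def by (simp add: add_pos_nonneg sum_nonneg)
  have "\<bar>inflow w W\<bar> < M" for W
  proof -
    have "\<bar>inflow w W\<bar> \<le> (\<Sum>e\<in>arcs G. \<bar>w e\<bar>)"
      unfolding inflow_def by (rule order_trans[OF sum_abs sum_mono]) auto
    then show ?thesis by (simp add: M_def)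
  qed
  then show ?thesis
    using M by (intro exI[of _ "1 / M"]) (simp add: abs_mult)
qed

end

section \<open>Comparison of the two shifts\<close>

lemma ceiling_perturbed:
  fixes x :: real
  assumes "x \<noteq> 0" "\<bar>x\<bar> < 1"
  shows "\<lceil>of_int k + x\<rceil> = k + of_bool (0 < x)"
  using assms by (auto simp: ceiling_eq_iff)

lemma shifted_break_divisors_cong:
  assumes "\<And>T. T \<in> spanning_trees G \<Longrightarrow> I T = J T"
  shows "shifted_break_divisors G I = shifted_break_divisors G J"
  unfolding shifted_break_divisors_def
  by (intro Collect_cong ex_cong1) (use assms in auto)

theorem theoremB:
  fixes G :: "('v, 'e) pre_digraph" and q :: 'v
    and \<sigma> :: "'e set \<Rightarrow> ('e \<times> bool) set"
  assumes "connected_multigraph G"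
    and "q \<in> verts G"
    and "cocycle_signature G \<sigma>"
    and "acyclic_signature G \<sigma>"
  shows "\<exists>\<phi> :: 'v \<Rightarrow> real.
      numerical_polarization G (genus G) \<phi> \<and> generic_polarization G \<phi> \<and>
      shifted_break_divisors G (signature_shift G q \<sigma>)
        = shifted_break_divisors G (assignment_shift G (polarization_assignment G \<phi>))"
proof -
  interpret connected_multigraph G by fact
  obtain w where w: "\<forall>C\<in>cocycles G. 0 < (\<Sum>e\<in>arcs G. w e * signed_vector (\<sigma> C) e)"
    using acyclic_signature_positive_weights[OF finite_arcs assms(4)] by blast
  obtain \<epsilon> where \<epsilon>: "0 < \<epsilon>" "\<And>W. W \<subseteq> verts G \<Longrightarrow> \<bar>\<epsilon> * inflow w W\<bar> < 1"
    using exists_small_inflow by blast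
  let ?\<phi> = "perturbed_polarization q \<epsilon> w"
  have nonzero: "\<epsilon> * inflow w W \<noteq> 0" if "nontrivial G W" "biconnected G W" for W
    using signature_edge_cut(1)[OF assms(3) w that] \<epsilon>(1) by simp
  have "numerical_polarization G (genus G) ?\<phi>"
  proof -
    \<comment> \<open>For the whole vertex set the sum formula reduces to
      \<open>genus G - 1 + 1\<close>, the last unit coming from \<open>q\<close>.\<close>
    have "edge_cut G (verts G) = {}" "inflow w (verts G) = 0" "genus (G \<restriction> verts G) = genus G"
      by (auto simp: edge_cut_def inflow_def genus_def intro!: arg_cong[where f = card])
    then show ?thesis
      using sum_perturbed_polarization[of "verts G" q \<epsilon> w] assms(2)
      by (simp add: numerical_polarization_def)
  qed
  moreover have "generic_polarization G ?\<phi>"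
    unfolding generic_polarization_def
  proof (intro allI impI)
    fix W assume W: "nontrivial G W \<and> biconnected G W"
    then have "W \<subseteq> verts G" by (simp add: nontrivial_def)
    then show "(\<Sum>v\<in>W. ?\<phi> v) - real (card (edge_cut G W)) / 2 \<notin> \<int>"
      unfolding sum_perturbed_polarization[OF \<open>W \<subseteq> verts G\<close>]
      \<comment> \<open>An integer plus a nonzero number of absolute value below one is not an
        integer.\<close>
      using Ints_nonzero_abs_less1[OF _ \<epsilon>(2)[OF \<open>W \<subseteq> verts G\<close>]] W nonzero[of W] by auto
  qed
  moreover have "signature_shift G q \<sigma> T = assignment_shift G (polarization_assignment G ?\<phi>) T"
    if T: "T \<in> spanning_trees G" for T
  proof (rule assignment_shift_eqI[symmetric, OF T])
    show "signature_shift G q \<sigma> T \<in> divisors_of_degree G 0"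
      by (rule signature_shift_degree_0[OF assms(3) w T assms(2)])
    fix e W assume e: "e \<in> T" and W: "W \<in> component (T - {e}) ` verts G"
    have nt: "nontrivial G W" "biconnected G W"
      by (rule induced_head_in_fundamental_component(2,3)[OF assms(3) w T e W])+
    then have sub: "W \<subseteq> verts G" by (simp add: nontrivial_def)
    \<comment> \<open>The perturbation is nonzero and smaller than one, so the ceiling records only
      its sign. Subtracting the genus leaves the sum of the signature shift.\<close>
    have "polarization_assignment G ?\<phi> W =
        genus (G \<restriction> W) - 1 + of_bool (q \<in> W) + of_bool (0 < \<epsilon> * inflow w W)"
      unfolding polarization_assignment_def sum_perturbed_polarization[OF sub]
      by (rule ceiling_perturbed) (use nonzero nt \<epsilon>(2) sub in auto)
    then show "(\<Sum>v\<in>W. signature_shift G q \<sigma> T v) =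
        polarization_assignment G ?\<phi> W - genus (G \<restriction> W)"
      using sum_signature_shift_fundamental_component[OF assms(3) w T e W] \<epsilon>(1)
      by (simp add: zero_less_mult_iff)
  qed
  then have "shifted_break_divisors G (signature_shift G q \<sigma>) =
      shifted_break_divisors G (assignment_shift G (polarization_assignment G ?\<phi>))"
    by (rule shifted_break_divisors_cong)
  ultimately show ?thesis by blast
qed

end
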